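(* Let $A=(000;0101)$ and $B=(000;1212)$ be the two square loops in $Q_3$, and let $w_{AB}=AB$ and $w_{BA}=BA$ be their concatenations. Then $w_{AB}$ and $w_{BA}$ have the same directed transition counts but different reduced loop words: $$\tau_{w_{AB}}=\tau_{w_{BA}},\qquad \rho(w_{AB})\neq\rho(w_{BA}).$$
   Context: $Q_3$ is the $1$-skeleton (graph) of the three-dimensional cube, with vertex set $V=\{0,1\}^3$ and coordinates numbered $0,1,2$; two vertices are adjacent iff they differ in exactly one coordinate. A vertex is written $b_2b_1b_0$ ($b_i$ the $i$-th coordinate) and identified with the integer $4b_2+2b_1+b_0\in\{0,\ldots,7\}$. A step in direction $i$ flips the $i$-th coordinate. The basepoint is $o=000$. A walk is $w=(o;a_1a_2\cdots a_n)$ with $n\ge0$, $a_k\in\{0,1,2\}$; its vertex sequence is $v_0=o,v_1,\ldots,v_n$, where $v_k$ is obtained from $v_{k-1}$ by flipping coordinate $a_k$. It is closed if $v_n=o$. The set $\mathcal W$ of based closed walks is a monoid under concatenation of step sequences, with identity the empty walk; two walks are equal iff their step sequences coincide. Reduced loop word: fix the spanning tree of $Q_3$ given by the path $000,001,011,010,110,111,101,100$ (i.e. $0,1,3,2,6,7,5,4$). The five remaining (cotree) edges $(0,2),(0,4),(1,5),(3,7),(4,6)$ are oriented from the smaller to the larger integer and denoted $x_1,\ldots,x_5$ in this order; $F_5$ is the free group on $x_1,\ldots,x_5$. For $w\in\mathcal W$, reading the steps of $w$ in order, a forward crossing of the $i$-th cotree edge contributes $x_i$, a backward crossing contributes $x_i^{-1}$,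 and a tree edge contributes nothing; the resulting word is $\ell(w)$, and $\rho(w)\in F_5$ is its free reduction. The directed transition count is $\tau_w:V\times V\to\mathbb N$, $\tau_w(p,q)=\#\{k:1\le k\le n,\ (v_{k-1},v_k)=(p,q)\}$. *)

theory Defs
  imports "HOL-Library.Numeral_Type" "HOL-Algebra.Group"
begin

section \<open>The cube graph\<close>

text \<open>A coordinate index is an element of the three-element type \<open>3\<close>, that is \<open>0\<close>, \<open>1\<close> or \<open>2\<close>
  (beware that \<open>3 = 0\<close> there). A vertex is its family of bits, \<open>True\<close> standing for 1.\<close>

type_synonym vertex = "3 \<Rightarrow> bool"

definition origin :: vertex where
  "origin = (\<lambda>_. False)"

definition code :: "vertex \<Rightarrow> nat" where
  "code v = 4 * of_bool (v 2) + 2 * of_bool (v 1) + of_bool (v 0)"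

definition adjacent :: "vertex \<Rightarrow> vertex \<Rightarrow> bool" where
  "adjacent p q \<longleftrightarrow> card {i. p i \<noteq> q i} = 1"

definition flip :: "3 \<Rightarrow> vertex \<Rightarrow> vertex" where
  "flip i v = v(i := \<not> v i)"


section \<open>Based closed walks\<close>

text \<open>\<open>position a k\<close> is the vertex \<open>v\<^sub>k\<close> of the walk from the origin with step sequence \<open>a\<close>.\<close>

definition position :: "3 list \<Rightarrow> nat \<Rightarrow> vertex" where
  "position a k = fold flip (take k a) origin"

typedef closed_walk = "{a :: 3 list. position a (length a) = origin}"
  morphisms steps Walk
  by (rule exI[of _ "[]"]) (simp add: position_def)

setup_lifting type_definition_closed_walk

instantiation closed_walk :: monoid_mult
begin

lift_definition one_closed_walk :: closed_walk is "[]"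
  by (simp add: position_def)

lift_definition times_closed_walk :: "closed_walk \<Rightarrow> closed_walk \<Rightarrow> closed_walk" is "(@)"
  by (simp add: position_def)

instance
  by standard (transfer; simp)+

end

definition walk_length :: "closed_walk \<Rightarrow> nat" where
  "walk_length w = length (steps w)"

definition walk_vertex :: "closed_walk \<Rightarrow> nat \<Rightarrow> vertex" where
  "walk_vertex w k = position (steps w) k"

definition transition_count :: "closed_walk \<Rightarrow> vertex \<times> vertex \<Rightarrow> nat" where
  "transition_count w =
     (\<lambda>(p, q). card {k \<in> {1..walk_length w}. (walk_vertex w (k - 1), walk_vertex w k) = (p, q)})"


section \<open>Free groups\<close>

text \<open>The letter \<open>(x, True)\<close> is the generator \<open>x\<close>, and \<open>(x, False)\<close> is its formal inverse.\<close>

type_synonym 'a word = "('a \<times> bool) list"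

definition inv_letter :: "'a \<times> bool \<Rightarrow> 'a \<times> bool" where
  "inv_letter l = (fst l, \<not> snd l)"

definition reduced :: "'a word \<Rightarrow> bool" where
  "reduced u \<longleftrightarrow> (\<nexists>r l s. u = r @ [l, inv_letter l] @ s)"

inductive cancels :: "'a word \<Rightarrow> 'a word \<Rightarrow> bool" where
  "cancels (r @ [l, inv_letter l] @ s) (r @ s)"

fun cons_reduce :: "'a \<times> bool \<Rightarrow> 'a word \<Rightarrow> 'a word" where
  "cons_reduce l [] = [l]"
| "cons_reduce l (m # u) = (if m = inv_letter l then u else l # m # u)"

definition free_reduction :: "'a word \<Rightarrow> 'a word" where
  "free_reduction u = foldr cons_reduce u []"

text \<open>An element of the free group is represented by the unique reduced word in its class.\<close>

definition free_group :: "'a set \<Rightarrow> 'a word monoid" where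
  "free_group X =
     \<lparr>carrier = {u. reduced u \<and> fst ` set u \<subseteq> X},
      mult = (\<lambda>u v. free_reduction (u @ v)),
      one = []\<rparr>"

lemma inv_letter_inv_letter [simp]: "inv_letter (inv_letter l) = l"
  by (simp add: inv_letter_def)

lemma inv_letter_neq [simp]: "inv_letter l \<noteq> l" "l \<noteq> inv_letter l"
  by (auto simp: inv_letter_def prod_eq_iff)

lemma fst_inv_letter [simp]: "fst (inv_letter l) = fst l"
  by (simp add: inv_letter_def)

lemma reduced_Nil [simp]: "reduced []"
  by (simp add: reduced_def)

lemma reduced_Cons:
  "reduced (l # u) \<longleftrightarrow> reduced u \<and> (u = [] \<or> hd u \<noteq> inv_letter l)"
proof -
  have "(\<exists>r m s. l # u = r @ [m, inv_letter m] @ s) \<longleftrightarrow>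
        (\<exists>s. u = inv_letter l # s) \<or> (\<exists>r m s. u = r @ [m, inv_letter m] @ s)"
    (is "?L \<longleftrightarrow> ?R")
  proof
    assume ?L
    then obtain r m s where *: "l # u = r @ [m, inv_letter m] @ s"
      by blast
    show ?R
    proof (cases r)
      case Nil
      with * show ?thesis by simp
    next
      case (Cons n t)
      with * have "u = t @ [m, inv_letter m] @ s" by simp
      then show ?thesis by blast
    qed
  next
    assume ?R
    then show ?L
      by (metis append_Cons append_Nil)
  qed
  then show ?thesis
    unfolding reduced_def by (cases u) auto
qed

lemma reduced_cons_reduce: "reduced u \<Longrightarrow> reduced (cons_reduce l u)"
  by (cases u) (auto simp: reduced_Cons)

lemma cons_reduce_cancel: "reduced u \<Longrightarrow> cons_reduce l (cons_reduce (inv_letter l) u) = u"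
  by (cases u; cases "tl u") (auto simp: reduced_Cons)

lemma free_reduction_simps [simp]:
  "free_reduction [] = []"
  "free_reduction (l # u) = cons_reduce l (free_reduction u)"
  by (simp_all add: free_reduction_def)

lemma reduced_free_reduction: "reduced (free_reduction u)"
  by (induction u) (simp_all add: reduced_cons_reduce)

lemma free_reduction_reduced: "reduced u \<Longrightarrow> free_reduction u = u"
proof (induction u)
  case (Cons l u)
  then show ?case by (cases u) (auto simp: reduced_Cons)
qed simp

lemma free_reduction_append:
  "free_reduction (u @ v) = foldr cons_reduce u (free_reduction v)"
  by (simp add: free_reduction_def)

lemma free_reduction_cancels: "cancels u v \<Longrightarrow> free_reduction u = free_reduction v"
  by (induction rule: cancels.induct)
    (simp add: free_reduction_append cons_reduce_cancel reduced_free_reduction)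

lemma cancels_Cons: "cancels u v \<Longrightarrow> cancels (l # u) (l # v)"
  by (metis append_Cons cancels.simps)

lemma cancels_rtranclp_Cons: "cancels\<^sup>*\<^sup>* u v \<Longrightarrow> cancels\<^sup>*\<^sup>* (l # u) (l # v)"
  by (induction rule: rtranclp_induct) (auto intro: rtranclp.rtrancl_into_rtrancl cancels_Cons)

lemma cancels_free_reduction: "cancels\<^sup>*\<^sup>* u (free_reduction u)"
proof (induction u)
  case (Cons l u)
  have "cancels\<^sup>*\<^sup>* (l # v) (cons_reduce l v)" for v
    using cancels.intros[of "[]" l] by (cases v) auto
  with cancels_rtranclp_Cons[OF Cons] show ?case
    by (metis free_reduction_simps(2) rtranclp_trans)
qed simp

theorem free_reduction_iff: "free_reduction u = v \<longleftrightarrow> cancels\<^sup>*\<^sup>* u v \<and> reduced v"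
proof
  assume "cancels\<^sup>*\<^sup>* u v \<and> reduced v"
  moreover have "cancels\<^sup>*\<^sup>* u v \<Longrightarrow> free_reduction u = free_reduction v"
    by (induction rule: rtranclp_induct) (simp_all add: free_reduction_cancels)
  ultimately show "free_reduction u = v"
    by (simp add: free_reduction_reduced)
qed (auto simp: cancels_free_reduction reduced_free_reduction)

lemma free_reduction_append_left: "free_reduction (u @ free_reduction v) = free_reduction (u @ v)"
  by (simp add: free_reduction_append free_reduction_reduced reduced_free_reduction)

lemma foldr_cons_reduce_cons_reduce:
  assumes "reduced v"
  shows "foldr cons_reduce (cons_reduce l u) v = cons_reduce l (foldr cons_reduce u v)"
proof (cases u)
  case (Cons m t)
  have "reduced (foldr cons_reduce t v)"
    using assms by (induction t) (simp_all add: reduced_cons_reduce)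
  with Cons show ?thesis
    by (auto simp: cons_reduce_cancel)
qed simp

lemma free_reduction_append_right: "free_reduction (free_reduction u @ v) = free_reduction (u @ v)"
  by (induction u)
    (simp_all add: free_reduction_append foldr_cons_reduce_cons_reduce reduced_free_reduction)

lemma set_cons_reduce: "set (cons_reduce l u) \<subseteq> insert l (set u)"
  by (cases u) auto

lemma set_free_reduction: "set (free_reduction u) \<subseteq> set u"
proof (induction u)
  case (Cons l u)
  then show ?case using set_cons_reduce[of l "free_reduction u"] by auto
qed simp

lemma free_reduction_inverse_left: "free_reduction (rev (map inv_letter u) @ u) = []"
proof (induction u)
  case (Cons l u)
  have "cancels (rev (map inv_letter (l # u)) @ l # u) (rev (map inv_letter u) @ u)"
    using cancels.intros[of "rev (map inv_letter u)" "inv_letter l" u] by simp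
  with Cons show ?case
    using free_reduction_cancels by metis
qed simp

theorem group_free_group: "group (free_group X)"
proof (rule groupI)
  fix u v assume "u \<in> carrier (free_group X)" "v \<in> carrier (free_group X)"
  then show "u \<otimes>\<^bsub>free_group X\<^esub> v \<in> carrier (free_group X)"
    using set_free_reduction[of "u @ v"]
    by (fastforce simp: free_group_def reduced_free_reduction)
next
  fix u assume u: "u \<in> carrier (free_group X)"
  define v where "v = free_reduction (rev (map inv_letter u))"
  have "fst ` set v \<subseteq> X"
  proof -
    have "set v \<subseteq> inv_letter ` set u"
      using set_free_reduction[of "rev (map inv_letter u)"] by (simp add: v_def)
    then have "fst ` set v \<subseteq> fst ` inv_letter ` set u"
      by blast
    also have "\<dots> = fst ` set u"
      by (simp add: image_image)
    finally show ?thesis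
      using u by (auto simp: free_group_def)
  qed
  moreover have "free_reduction (v @ u) = []"
    by (simp add: v_def free_reduction_append_right free_reduction_inverse_left)
  moreover have "reduced v"
    by (simp add: v_def reduced_free_reduction)
  ultimately show "\<exists>v\<in>carrier (free_group X). v \<otimes>\<^bsub>free_group X\<^esub> u = \<one>\<^bsub>free_group X\<^esub>"
    by (intro bexI[of _ v]) (simp_all add: free_group_def)
qed (simp_all add: free_group_def free_reduction_append_left free_reduction_append_right
       free_reduction_reduced)


section \<open>Reduced loop words\<close>

text \<open>Edges are written through the integer codes of their endpoints.
  The generator \<open>x\<^sub>i\<close> of \<open>F\<^sub>5\<close> is the index \<open>i \<in> {1..5}\<close>.\<close>

definition tree_path :: "nat list" where
  "tree_path = [0, 1, 3, 2, 6, 7, 5, 4]"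

definition tree_edges :: "nat set set" where
  "tree_edges = (\<lambda>j. {tree_path ! j, tree_path ! Suc j}) ` {..<7}"

definition cotree_edge :: "nat \<Rightarrow> nat \<times> nat" where
  "cotree_edge i = [(0, 2), (0, 4), (1, 5), (3, 7), (4, 6)] ! (i - 1)"

abbreviation F5 :: "nat word monoid" where
  "F5 \<equiv> free_group {1..5}"

definition crossing :: "vertex \<Rightarrow> vertex \<Rightarrow> nat word" where
  "crossing p q =
     [(i, True). i \<leftarrow> [1..<6], (code p, code q) = cotree_edge i] @
     [(i, False). i \<leftarrow> [1..<6], (code q, code p) = cotree_edge i]"

definition loop_word :: "closed_walk \<Rightarrow> nat word" where
  "loop_word w =
     concat (map (\<lambda>k. crossing (walk_vertex w (k - 1)) (walk_vertex w k)) [1..<Suc (walk_length w)])"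

definition reduced_loop_word :: "closed_walk \<Rightarrow> nat word" where
  "reduced_loop_word w = free_reduction (loop_word w)"

lemma reduced_loop_word_in_F5: "reduced_loop_word w \<in> carrier F5"
proof -
  have "fst ` set (crossing p q) \<subseteq> {1..5}" for p q
    unfolding crossing_def by (auto simp del: upt_rec_numeral upt_conv_Cons)
  then have "fst ` set (loop_word w) \<subseteq> {1..5}"
    unfolding loop_word_def set_concat set_map image_UN by blast
  then have "fst ` set (free_reduction (loop_word w)) \<subseteq> {1..5}"
    using set_free_reduction[of "loop_word w"] by blast
  then show ?thesis
    by (simp add: reduced_loop_word_def free_group_def reduced_free_reduction)
qed

lemma UNIV_3: "(UNIV :: 3 set) = {0, 1, 2}"
  by (rule card_subset_eq[symmetric]) simp_all

lemma adjacent_iff: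
  "adjacent p q \<longleftrightarrow>
     of_bool (p 0 \<noteq> q 0) + of_bool (p 1 \<noteq> q 1) + of_bool (p 2 \<noteq> q 2) = (1 :: nat)"
proof -
  have "card {i. p i \<noteq> q i} = (\<Sum>i\<in>UNIV. of_bool (p i \<noteq> q i))"
    by simp
  also have "\<dots> = of_bool (p 0 \<noteq> q 0) + of_bool (p 1 \<noteq> q 1) + of_bool (p 2 \<noteq> q 2)"
    unfolding UNIV_3 by simp
  finally show ?thesis
    by (simp add: adjacent_def)
qed

lemma adjacent_iff_flip: "adjacent p q \<longleftrightarrow> (\<exists>i. q = flip i p)"
proof -
  have "adjacent p q \<longleftrightarrow> (\<exists>i. {j. p j \<noteq> q j} = {i})"
    by (simp add: adjacent_def card_1_singleton_iff)
  also have "\<dots> \<longleftrightarrow> (\<exists>i. q = flip i p)"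
    by (intro ex_cong1) (auto simp: flip_def fun_eq_iff set_eq_iff)
  finally show ?thesis .
qed

lemma bij_betw_code: "bij_betw code UNIV {..<8}"
proof (rule bij_betw_imageI)
  show "inj code"
  proof (rule injI)
    fix p q assume "code p = code q"
    then have "p 0 = q 0 \<and> p 1 = q 1 \<and> p 2 = q 2"
      unfolding code_def
      by (cases "p 0"; cases "p 1"; cases "p 2"; cases "q 0"; cases "q 1"; cases "q 2") simp_all
    then have "\<forall>i\<in>{0, 1, 2}. p i = q i"
      by blast
    then show "p = q"
      unfolding UNIV_3[symmetric] by (simp add: fun_eq_iff)
  qed
  then have "card (range code) = card {..<8 :: nat}"
    by (simp add: card_image card_fun)
  moreover have "range code \<subseteq> {..<8}"
    by (auto simp: code_def of_bool_def)
  ultimately show "range code = {..<8}"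
    by (simp add: card_subset_eq)
qed

lemma cotree_edges:
  "(code p, code q) \<in> cotree_edge ` {1..5} \<longleftrightarrow>
     adjacent p q \<and> code p < code q \<and> {code p, code q} \<notin> tree_edges"
proof -
  have I: "{1..5 :: nat} = {1, 2, 3, 4, 5}" "{..<7 :: nat} = {0, 1, 2, 3, 4, 5, 6}"
    by auto
  show ?thesis
    unfolding I adjacent_iff tree_edges_def tree_path_def cotree_edge_def code_def
    by (cases "p 0"; cases "p 1"; cases "p 2"; cases "q 0"; cases "q 1"; cases "q 2")
      (simp_all add: doubleton_eq_iff)
qed


section \<open>The two square loops\<close>

lift_definition square_A :: closed_walk is "[0, 1, 0, 1]"
  by (simp add: position_def flip_def origin_def fun_eq_iff)

lift_definition square_B :: closed_walk is "[1, 2, 1, 2]"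
  by (simp add: position_def flip_def origin_def fun_eq_iff)

definition w_AB :: closed_walk where
  "w_AB = square_A * square_B"

definition w_BA :: closed_walk where
  "w_BA = square_B * square_A"

end

theory Submission
  imports Defs
begin

text \<open>Concatenating two based closed walks traverses first the steps of the one and then those of
  the other, from the same vertices as before, because the first walk ends at the basepoint. Hence
  transition counts are additive (\<open>transition_count_times\<close>), so they do not see the order of the
  factors, whereas loop words are concatenated (\<open>loop_word_times\<close>), so that reduced
  loop words multiply in a noncommutative group. Along the vertices \<open>0, 1, 3, 2, 0\<close> the first square crosses only
  the cotree edge \<open>(0, 2)\<close>, backwards; along \<open>0, 2, 6, 4, 0\<close> the second one crosses \<open>(0, 2)\<close>
  forwards and then \<open>(4, 6)\<close> and \<open>(0, 4)\<close> backwards. So the loop words are \<open>x\<^sub>1\<inverse>\<close> and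
  \<open>x\<^sub>1 x\<^sub>5\<inverse> x\<^sub>2\<inverse>\<close>. With the first square in front, their product reduces to \<open>x\<^sub>5\<inverse> x\<^sub>2\<inverse>\<close>, while in the other order
  \<open>x\<^sub>1 x\<^sub>5\<inverse> x\<^sub>2\<inverse> x\<^sub>1\<inverse>\<close> is already reduced.\<close>

lemma walk_length_times: "walk_length (v * w) = walk_length v + walk_length w"
  by (simp add: walk_length_def times_closed_walk.rep_eq)

lemma walk_vertex_times_left:
  "k \<le> walk_length v \<Longrightarrow> walk_vertex (v * w) k = walk_vertex v k"
  by (simp add: walk_length_def walk_vertex_def position_def times_closed_walk.rep_eq)

text \<open>The left factor ends at the origin, where the right factor starts. So the right factor visits
  the same vertices within the product as it does on its own.\<close>

lemma walk_vertex_times_right: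
  "walk_vertex (v * w) (walk_length v + k) = walk_vertex w k"
  using steps[of v]
  by (simp add: walk_length_def walk_vertex_def position_def times_closed_walk.rep_eq)

lemma transition_count_times:
  "transition_count (v * w) e = transition_count v e + transition_count w e"
proof -
  \<comment> \<open>The steps of the product that traverse \<open>e\<close> are those of the left factor together with those
    of the right factor, shifted by the length of the left one.\<close>
  define S where
    "S u = {k \<in> {1..walk_length u}. (walk_vertex u (k - 1), walk_vertex u k) = e}" for u
  have count: "transition_count u e = card (S u)" for u
    by (cases e) (simp add: transition_count_def S_def)
  let ?m = "walk_length v"
  have left: "k \<in> S (v * w) \<longleftrightarrow> k \<in> S v" if "k \<le> ?m" for k
    using that by (auto simp: S_def walk_length_times walk_vertex_times_left)
  have right: "?m + k \<in> S (v * w) \<longleftrightarrow> k \<in> S w" if "1 \<le> k" for k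
  proof -
    have "walk_vertex (v * w) (?m + k - 1) = walk_vertex w (k - 1)"
      using that walk_vertex_times_right[of v w "k - 1"] by simp
    then show ?thesis
      using that unfolding S_def walk_length_times by (auto simp: walk_vertex_times_right)
  qed
  have "S (v * w) = S v \<union> (+) ?m ` S w"
  proof (rule Set.set_eqI)
    fix k
    show "k \<in> S (v * w) \<longleftrightarrow> k \<in> S v \<union> (+) ?m ` S w"
    proof (cases "k \<le> ?m")
      case True
      then show ?thesis
        using left[of k] by (auto simp: S_def)
    next
      case False
      then obtain j where "k = ?m + j" "1 \<le> j"
        by (intro that[of "k - ?m"]) auto
      then show ?thesis
        using right[of j] by (auto simp: S_def)
    qed
  qed
  moreover have "S v \<inter> (+) ?m ` S w = {}" "finite (S v)" "finite (S w)"
    by (auto simp: S_def)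
  ultimately show ?thesis
    by (simp add: count card_Un_disjoint card_image)
qed

corollary transition_count_commute: "transition_count (v * w) = transition_count (w * v)"
  by (simp add: fun_eq_iff transition_count_times)

lemma loop_word_times: "loop_word (v * w) = loop_word v @ loop_word w"
proof -
  let ?m = "walk_length v" and ?n = "walk_length w"
  let ?c = "\<lambda>u k. crossing (walk_vertex u (k - 1)) (walk_vertex u k)"
  have "[1..<Suc (?m + ?n)] = [1..<Suc ?m] @ map (\<lambda>k. k + ?m) [1..<Suc ?n]"
    by (intro nth_equalityI) (auto simp: nth_append simp del: upt_Suc)
  moreover have "map (?c (v * w)) [1..<Suc ?m] = map (?c v) [1..<Suc ?m]"
    by (rule map_cong) (auto simp: walk_vertex_times_left simp del: upt_Suc)
  moreover have "map (?c (v * w)) (map (\<lambda>k. k + ?m) [1..<Suc ?n]) = map (?c w) [1..<Suc ?n]"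
  proof -
    have "?c (v * w) (k + ?m) = ?c w k" if "1 \<le> k" for k
    proof -
      have "k + ?m - 1 = ?m + (k - 1)"
        using that by simp
      then show ?thesis
        by (simp add: walk_vertex_times_right add.commute[of k])
    qed
    then show ?thesis
      by (simp del: upt_Suc)
  qed
  ultimately show ?thesis
    unfolding loop_word_def walk_length_times by (simp only: map_append concat_append)
qed

lemma loop_word_square_A: "loop_word square_A = [(1, False)]"
  by (simp add: loop_word_def walk_length_def walk_vertex_def square_A.rep_eq position_def
      crossing_def cotree_edge_def code_def flip_def origin_def upt_rec)

lemma loop_word_square_B: "loop_word square_B = [(1, True), (5, False), (2, False)]"
  by (simp add: loop_word_def walk_length_def walk_vertex_def square_B.rep_eq position_def
      crossing_def cotree_edge_def code_def flip_def origin_def upt_rec)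

theorem theorem3p4:
  shows "transition_count w_AB = transition_count w_BA
    \<and> reduced_loop_word w_AB \<noteq> reduced_loop_word w_BA"
proof
  show "transition_count w_AB = transition_count w_BA"
    unfolding w_AB_def w_BA_def by (rule transition_count_commute)
  have "reduced_loop_word w_AB = [(5, False), (2, False)]"
    by (simp add: reduced_loop_word_def w_AB_def loop_word_times loop_word_square_A
        loop_word_square_B inv_letter_def)
  moreover have "reduced_loop_word w_BA = [(1, True), (5, False), (2, False), (1, False)]"
    by (simp add: reduced_loop_word_def w_BA_def loop_word_times loop_word_square_A
        loop_word_square_B inv_letter_def)
  ultimately show "reduced_loop_word w_AB \<noteq> reduced_loop_word w_BA"
    by simp
qed

end
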